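(* Let $\mathbf m$, $\mathbf n$ be strictly increasing sequences of positive integers such that the difference set $\Delta_{\mathbf m,\mathbf n}$ is infinite. Then there exists a $1$-unconditional basis $\mathcal B$ (of some Banach space) that is $1$-($\mathbf n$, PSLC) but is not ($\mathbf m$, conservative) (and thus, not democratic).
   Context: The sequences $\mathbf m,\mathbf n$ are identified with their sets of terms, and $\Delta_{\mathbf m,\mathbf n}=\{i:i\in\mathbf m,i\notin\mathbf n\}\cup\{i:i\in\mathbf n,i\notin\mathbf m\}$ is their symmetric difference. Banach spaces are separable, infinite-dimensional, over $\mathbb F=\mathbb R$ or $\mathbb C$; $\mathbb N=\{1,2,\dots\}$. A basis of $X$ is a sequence $\mathcal B=(e_n)_{n\ge1}\subset X$ whose linear span is norm-dense and for which there is a sequence $(e_n^* )_{n\ge1}\subset X^*$ with $e_j^*(e_k)=\delta_{j,k}$ and $0<\inf_n\{\|e_n\|,\|e_n^*\|\}\le\sup_n\{\|e_n\|,\|e_n^*\|\}<\infty$. It is $1$-unconditional if for all $N\in\mathbb N$, $\|\sum_{n=1}^Na_ne_n\|\le\|\sum_{n=1}^Nb_ne_n\|$ whenever $|a_n|\le|b_n|$ for $1\le n\le N$. A sign is a sequence $\varepsilon=(\varepsilon_n)_n$ of scalars of modulus $1$; for finite $A$, $1_{\varepsilon A}=\sum_{n\in A}\varepsilon_ne_n$ and $1_A=\sum_{n\in A}e_n$; $\|x\|_\infty=\max_n|e_n^*(x)|$; $\operatorname{supp}(x)=\{n:e_n^*(x)\ne0\}$; $A<B$ means $a<b$ for all $a\in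 A,b\in B$ (vacuous if one is empty). $\mathcal B$ is $1$-($\mathbf n$, PSLC) if $\|x+1_{\varepsilon A}\|\le\|x+1_{\delta B}\|$ for all $x\in X$ with $\|x\|_\infty\le1$, all finite sets $A\subset\mathbf n$, $B\subset\mathbb N$ with $|A|\le|B|$, $B\cap\operatorname{supp}(x)=\emptyset$ and $A<(B\cup\operatorname{supp}(x))\cap\mathbf n$, and all signs $\varepsilon,\delta$. $\mathcal B$ is ($\mathbf m$, conservative) if there is $C>0$ with $\|1_A\|\le C\|1_B\|$ for all finite sets $A\subset\mathbf m$, $B\subset\mathbb N$ with $|A|\le|B|$ and $A<B\cap\mathbf m$. $\mathcal B$ is democratic if there is $C\ge1$ with $\|1_A\|\le C\|1_B\|$ for all finite $A,B\subset\mathbb N$ with $|A|\le|B|$. *)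

theory Defs
  imports "HOL-Analysis.Analysis" "HOL-Library.Function_Algebras"
begin

text \<open>
  The norm is defined on a linear subspace \<open>V\<close> of an ambient vector space with scalar
  multiplication \<open>scale\<close>; its values outside \<open>V\<close> are irrelevant.
\<close>

locale normed_subspace = vector_space scale
  for scale :: "'k::real_normed_field \<Rightarrow> 'a::ab_group_add \<Rightarrow> 'a" +
  fixes V :: "'a set" and nrm :: "'a \<Rightarrow> real"
  assumes subspace_V: "subspace V"
    and nrm_nonneg: "x \<in> V \<Longrightarrow> 0 \<le> nrm x"
    and nrm_eq_0: "x \<in> V \<Longrightarrow> nrm x = 0 \<longleftrightarrow> x = 0"
    and nrm_triangle: "\<lbrakk>x \<in> V; y \<in> V\<rbrakk> \<Longrightarrow> nrm (x + y) \<le> nrm x + nrm y"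
    and nrm_scale: "x \<in> V \<Longrightarrow> nrm (scale c x) = norm c * nrm x"
begin

text \<open>\<^locale>\<open>Metric_space\<close> wants nonnegativity and symmetry off the carrier too, hence the case split.\<close>

definition ndist :: "'a \<Rightarrow> 'a \<Rightarrow> real"
  where "ndist x y = (if x \<in> V \<and> y \<in> V then nrm (x - y) else 0)"

sublocale Metric_space V ndist
proof
  have neg: "nrm (x - y) = nrm (y - x)" if "x \<in> V" "y \<in> V" for x y
    using nrm_scale[of "y - x" "-1"] subspace_diff[OF subspace_V] that by simp
  show "0 \<le> ndist x y" for x y
    by (auto simp: ndist_def intro: nrm_nonneg subspace_diff[OF subspace_V])
  show "ndist x y = ndist y x" for x y
    by (auto simp: ndist_def neg)
  show "ndist x y = 0 \<longleftrightarrow> x = y" if "x \<in> V" "y \<in> V" for x y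
    using that nrm_eq_0[of "x - y"] subspace_diff[OF subspace_V] by (simp add: ndist_def)
  show "ndist x z \<le> ndist x y + ndist y z" if "x \<in> V" "y \<in> V" "z \<in> V" for x y z
    using that nrm_triangle[of "x - y" "y - z"] subspace_diff[OF subspace_V]
    by (simp add: ndist_def)
qed

definition continuous_functional :: "('a \<Rightarrow> 'k) \<Rightarrow> bool"
  where "continuous_functional f \<longleftrightarrow>
    (\<forall>x\<in>V. \<forall>y\<in>V. f (x + y) = f x + f y) \<and>
    (\<forall>c. \<forall>x\<in>V. f (scale c x) = c * f x) \<and>
    (\<exists>K. \<forall>x\<in>V. norm (f x) \<le> K * nrm x)"

definition dual_norm :: "('a \<Rightarrow> 'k) \<Rightarrow> real"
  where "dual_norm f = Sup {norm (f x) |x. x \<in> V \<and> nrm x \<le> 1}"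

end

locale separable_inf_dim_banach = normed_subspace +
  assumes complete_V: "mcomplete"
    and separable_V: "separable_space mtopology"
    and inf_dim_V: "\<nexists>S. finite S \<and> span S = V"

text \<open>
  Bases are indexed by the positive integers; \<open>e 0\<close> and \<open>es 0\<close> are never used.
  \<open>es n\<close> is the coordinate functional of \<open>e n\<close>. By density of the span it is uniquely
  determined on \<open>V\<close> by \<open>e\<close>, so carrying it as a parameter adds no freedom.
\<close>

locale banach_basis = separable_inf_dim_banach +
  fixes e :: "nat \<Rightarrow> 'b" and es :: "nat \<Rightarrow> 'b \<Rightarrow> 'a"
  assumes e_in_V: "1 \<le> n \<Longrightarrow> e n \<in> V"
    and span_dense: "mtopology closure_of span (e ` {1..}) = V"
    and es_dual: "1 \<le> n \<Longrightarrow> continuous_functional (es n)"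
    and biorthogonal: "\<lbrakk>1 \<le> j; 1 \<le> k\<rbrakk> \<Longrightarrow> es j (e k) = (if j = k then 1 else 0)"
    and seminormalized:
      "\<exists>c>0. \<exists>C. \<forall>n\<ge>1. c \<le> nrm (e n) \<and> nrm (e n) \<le> C \<and>
                       c \<le> dual_norm (es n) \<and> dual_norm (es n) \<le> C"
begin

definition one_unconditional :: bool
  where "one_unconditional \<longleftrightarrow>
    (\<forall>N\<ge>1. \<forall>a b. (\<forall>n\<in>{1..N}. norm (a n) \<le> norm (b n)) \<longrightarrow>
      nrm (\<Sum>n=1..N. scale (a n) (e n)) \<le> nrm (\<Sum>n=1..N. scale (b n) (e n)))"

definition sign :: "(nat \<Rightarrow> 'a) \<Rightarrow> bool"
  where "sign \<epsilon> \<longleftrightarrow> (\<forall>n\<ge>1. norm (\<epsilon> n) = 1)"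

definition signed_indicator :: "(nat \<Rightarrow> 'a) \<Rightarrow> nat set \<Rightarrow> 'b"
  where "signed_indicator \<epsilon> A = (\<Sum>n\<in>A. scale (\<epsilon> n) (e n))"

definition indicator_vec :: "nat set \<Rightarrow> 'b"
  where "indicator_vec A = (\<Sum>n\<in>A. e n)"

text \<open>
  For \<open>x \<in> V\<close> the coordinates are bounded and tend to \<open>0\<close>, so this supremum is a maximum.
\<close>

definition sup_norm :: "'b \<Rightarrow> real"
  where "sup_norm x = (SUP n\<in>{1..}. norm (es n x))"

definition supp :: "'b \<Rightarrow> nat set"
  where "supp x = {n. 1 \<le> n \<and> es n x \<noteq> 0}"

definition set_less :: "nat set \<Rightarrow> nat set \<Rightarrow> bool"
  where "set_less A B \<longleftrightarrow> (\<forall>a\<in>A. \<forall>b\<in>B. a < b)"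

text \<open>In the next two definitions a sequence is identified with the set of its terms, its range.\<close>

definition one_PSLC :: "(nat \<Rightarrow> nat) \<Rightarrow> bool"
  where "one_PSLC ns \<longleftrightarrow>
    (\<forall>x\<in>V. \<forall>A B \<epsilon> \<delta>.
      sup_norm x \<le> 1 \<and> finite A \<and> A \<subseteq> range ns \<and> finite B \<and> B \<subseteq> {1..} \<and>
      card A \<le> card B \<and> B \<inter> supp x = {} \<and>
      set_less A ((B \<union> supp x) \<inter> range ns) \<and> sign \<epsilon> \<and> sign \<delta> \<longrightarrow>
      nrm (x + signed_indicator \<epsilon> A) \<le> nrm (x + signed_indicator \<delta> B))"

definition conservative :: "(nat \<Rightarrow> nat) \<Rightarrow> bool"
  where "conservative ms \<longleftrightarrow>
    (\<exists>C>0. \<forall>A B.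
      finite A \<and> A \<subseteq> range ms \<and> finite B \<and> B \<subseteq> {1..} \<and>
      card A \<le> card B \<and> set_less A (B \<inter> range ms) \<longrightarrow>
      nrm (indicator_vec A) \<le> C * nrm (indicator_vec B))"

definition democratic :: bool
  where "democratic \<longleftrightarrow>
    (\<exists>C\<ge>1. \<forall>A B.
      finite A \<and> A \<subseteq> {1..} \<and> finite B \<and> B \<subseteq> {1..} \<and> card A \<le> card B \<longrightarrow>
      nrm (indicator_vec A) \<le> C * nrm (indicator_vec B))"

end

definition difference_set :: "(nat \<Rightarrow> nat) \<Rightarrow> (nat \<Rightarrow> nat) \<Rightarrow> nat set"
  where "difference_set ms ns =
    {i. i \<in> range ms \<and> i \<notin> range ns} \<union> {i. i \<in> range ns \<and> i \<notin> range ms}"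

text \<open>
  HOL cannot quantify existentially over types, so ``some Banach space over \<open>K\<close>'' is rendered as
  a subspace \<open>V\<close> of the space of all sequences \<open>nat \<Rightarrow> K\<close> with pointwise operations, under an
  arbitrary complete norm. Nothing is lost: for \<open>K\<close> the reals or the complex numbers, a separable
  Banach space has Hamel dimension at most that of \<open>nat \<Rightarrow> K\<close> (the cardinality of the continuum),
  hence is linearly isomorphic to such a \<open>V\<close>, to which its norm can be transported.
\<close>

definition seq_scale :: "'k::real_normed_field \<Rightarrow> (nat \<Rightarrow> 'k) \<Rightarrow> (nat \<Rightarrow> 'k)"
  where "seq_scale c f = (\<lambda>n. c * f n)"

end

theory Submission
  imports Defs
begin

text \<open>
  Let \<open>N\<close> be the set of terms of the sequence for which PSLC is wanted, \<open>M\<close> the set of terms of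
  the other one, and \<open>f\<close> a nondecreasing function with \<open>f \<ge> 1\<close>. The norm is
  \<open>\<parallel>x\<parallel> = sup (\<Sum>i\<in>S. \<bar>x i\<bar>)\<close> over all finite \<open>S\<close> with \<open>card (S \<inter> N) \<le> f i\<close> for every
  \<open>i \<in> S \<inter> N\<close>: the \<open>\<ell>\<^sub>1\<close>-norm off \<open>N\<close> plus a Schreier-type norm on \<open>N\<close>. On the closure of the
  finitely supported sequences, the unit vectors form a \<open>1\<close>-unconditional basis
  (\<open>coordinate_basis\<close>, \<open>one_unconditional_coordinate_basis\<close>).

  In this norm the points of \<open>N\<close> weigh more the further out they lie, and the points off \<open>N\<close>
  carry full weight. If a set \<open>S\<close> of the family is used to estimate \<open>x + 1\<^bsub>\<epsilon>A\<^esub>\<close> with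
  \<open>A \<subseteq> N\<close>, its points in \<open>A\<close> can be traded for equally many points of \<open>B\<close> without leaving the
  family, since \<open>B\<close> and the support of \<open>x\<close> meet \<open>N\<close> only beyond \<open>A\<close>
  (\<open>bounded_trace_exchange\<close>). This gives PSLC with constant \<open>1\<close> for every choice of \<open>f\<close>
  (\<open>one_PSLC_coordinate_basis\<close>).

  The choice of \<open>f\<close> serves to break conservativity along \<open>M\<close>, and depends on which half of the
  difference set is infinite. If \<open>M - N\<close> is infinite, take \<open>f = 1\<close>: sets in \<open>M - N\<close> carry the
  \<open>\<ell>\<^sub>1\<close>-norm, while sets in \<open>N\<close>, however far out, have norm \<open>1\<close> (\<open>trace_one_witness\<close>). If \<open>N - M\<close>
  is infinite, let \<open>f\<close> increase to infinity slowly compared with the counting function of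
  \<open>N - M\<close>: initial segments of \<open>N - M\<close> have small norm relative to their size, while sets of
  \<open>M\<close> of the same size that lie far out carry the \<open>\<ell>\<^sub>1\<close>-norm, and the order condition is empty
  because the small set misses \<open>M\<close> (\<open>slow_trace_witness\<close>).
\<close>

section \<open>The sequence space of a norming family\<close>

lemma sum_fun_apply: "(\<Sum>a\<in>A. f a) i = (\<Sum>a\<in>A. f a i)"
  for f :: "'a \<Rightarrow> 'b \<Rightarrow> 'c::comm_monoid_add"
  by (induction A rule: infinite_finite_induct) auto

definition unit_seq :: "nat \<Rightarrow> nat \<Rightarrow> 'k::real_normed_field"
  where "unit_seq n = (\<lambda>i. if i = n then 1 else 0)"

lemma vector_space_seq_scale:
  "vector_space (seq_scale :: 'k::real_normed_field \<Rightarrow> (nat \<Rightarrow> 'k) \<Rightarrow> (nat \<Rightarrow> 'k))"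
  by unfold_locales (auto simp: seq_scale_def fun_eq_iff algebra_simps)

lemma sum_unit_seq_apply:
  assumes "finite A"
  shows "(\<Sum>n\<in>A. seq_scale (a n) (unit_seq n)) i = (if i \<in> A then a i else 0)"
  using assms by (simp add: sum_fun_apply seq_scale_def unit_seq_def if_distrib cong: if_cong)

text \<open>
  Every finite set \<open>S \<in> F\<close> stands for the seminorm \<open>x \<mapsto> (\<Sum>i\<in>S. \<bar>x i\<bar>)\<close>, and the norm is the supremum of
  these. Singletons make it dominate every coordinate from \<open>1\<close> on, so that it is a norm on
  sequences with \<open>x 0 = 0\<close> and the coordinate functionals are bounded.
\<close>

locale norming_family =
  fixes F :: "nat set set"
  assumes finite_member: "S \<in> F \<Longrightarrow> finite S"
    and singleton_member: "1 \<le> i \<Longrightarrow> {i} \<in> F"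
begin

definition family_norm :: "(nat \<Rightarrow> 'k::real_normed_field) \<Rightarrow> real"
  where "family_norm x = (SUP S\<in>F. \<Sum>i\<in>S. norm (x i))"

text \<open>
  The closure of the finitely supported sequences, described by tails that vanish uniformly over
  \<open>F\<close>. This form is stable under coordinatewise limits that are uniform over \<open>F\<close>, and it
  implies that the supremum \<open>family_norm x\<close> is finite. The coordinate \<open>0\<close> is killed because bases
  are indexed from \<open>1\<close>.
\<close>

definition family_space :: "(nat \<Rightarrow> 'k::real_normed_field) set"
  where "family_space = {x. x 0 = 0 \<and>
    (\<forall>\<epsilon>>0. \<exists>N. \<forall>S\<in>F. (\<Sum>i\<in>S \<inter> {N<..}. norm (x i)) \<le> \<epsilon>)}"

lemma family_space_tail:
  assumes "x \<in> family_space" "\<epsilon> > 0"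
  obtains N where "\<And>S. S \<in> F \<Longrightarrow> (\<Sum>i\<in>S \<inter> {N<..}. norm (x i)) \<le> \<epsilon>"
  using assms unfolding family_space_def by blast

lemma F_nonempty: "F \<noteq> {}"
  using singleton_member[of 1] by auto

lemma sum_split_at:
  fixes x :: "nat \<Rightarrow> 'k::real_normed_field"
  assumes "S \<in> F"
  shows "(\<Sum>i\<in>S. norm (x i)) \<le> (\<Sum>i\<le>N. norm (x i)) + (\<Sum>i\<in>S \<inter> {N<..}. norm (x i))"
proof -
  have "(\<Sum>i\<in>S. norm (x i)) =
      (\<Sum>i\<in>S \<inter> {..N}. norm (x i)) + (\<Sum>i\<in>S - {..N}. norm (x i))"
    by (rule sum.Int_Diff[OF finite_member[OF assms]])
  also have "S - {..N} = S \<inter> {N<..}" by auto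
  finally have "(\<Sum>i\<in>S. norm (x i)) =
      (\<Sum>i\<in>S \<inter> {..N}. norm (x i)) + (\<Sum>i\<in>S \<inter> {N<..}. norm (x i))" .
  moreover have "(\<Sum>i\<in>S \<inter> {..N}. norm (x i)) \<le> (\<Sum>i\<le>N. norm (x i))"
    by (rule sum_mono2) auto
  ultimately show ?thesis by simp
qed

lemma family_space_bdd_above:
  fixes x :: "nat \<Rightarrow> 'k::real_normed_field"
  assumes "x \<in> family_space"
  shows "bdd_above ((\<lambda>S. \<Sum>i\<in>S. norm (x i)) ` F)"
proof -
  obtain N where N: "\<And>S. S \<in> F \<Longrightarrow> (\<Sum>i\<in>S \<inter> {N<..}. norm (x i)) \<le> 1"
    using family_space_tail[OF assms zero_less_one] by blast
  show ?thesis
    by (rule bdd_aboveI2[where M = "(\<Sum>i\<le>N. norm (x i)) + 1"])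
      (use sum_split_at[of _ x N] N in force)
qed

lemma sum_le_family_norm: "x \<in> family_space \<Longrightarrow> S \<in> F \<Longrightarrow> (\<Sum>i\<in>S. norm (x i)) \<le> family_norm x"
  unfolding family_norm_def by (rule cSUP_upper[OF _ family_space_bdd_above])

lemma family_norm_leI: "(\<And>S. S \<in> F \<Longrightarrow> (\<Sum>i\<in>S. norm (x i)) \<le> c) \<Longrightarrow> family_norm x \<le> c"
  unfolding family_norm_def by (rule cSUP_least[OF F_nonempty])

lemma family_norm_nonneg: "x \<in> family_space \<Longrightarrow> 0 \<le> family_norm x"
  using sum_le_family_norm[OF _ singleton_member[of 1], of x] order_trans[OF norm_ge_zero]
  by fastforce

lemma norm_le_family_norm: "x \<in> family_space \<Longrightarrow> norm (x i) \<le> family_norm x"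
  using sum_le_family_norm[OF _ singleton_member[of i], of x] family_norm_nonneg[of x]
  by (cases "i = 0") (auto simp: family_space_def)

lemma family_norm_le_sum:
  assumes "\<And>i. i > N \<Longrightarrow> x i = 0"
  shows "family_norm x \<le> (\<Sum>i\<le>N. norm (x i))"
proof (rule family_norm_leI)
  fix S assume "S \<in> F"
  moreover have "(\<Sum>i\<in>S \<inter> {N<..}. norm (x i)) = 0"
    by (rule sum.neutral) (use assms in auto)
  ultimately show "(\<Sum>i\<in>S. norm (x i)) \<le> (\<Sum>i\<le>N. norm (x i))"
    using sum_split_at[of S x N] by simp
qed

lemma family_norm_mono:
  assumes "x \<in> family_space" "\<And>i. norm (y i) \<le> norm (x i)"
  shows "family_norm y \<le> family_norm x"
proof (rule family_norm_leI)
  fix S assume "S \<in> F"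
  have "(\<Sum>i\<in>S. norm (y i)) \<le> (\<Sum>i\<in>S. norm (x i))"
    by (rule sum_mono) (rule assms(2))
  also have "\<dots> \<le> family_norm x" by (rule sum_le_family_norm[OF assms(1) \<open>S \<in> F\<close>])
  finally show "(\<Sum>i\<in>S. norm (y i)) \<le> family_norm x" .
qed

lemma finite_support_in_family_space:
  assumes "x 0 = 0" "\<And>i. i > N \<Longrightarrow> x i = 0"
  shows "x \<in> family_space"
proof -
  have "(\<Sum>i\<in>S \<inter> {N<..}. norm (x i)) = 0" for S
    by (rule sum.neutral) (use assms in auto)
  then show ?thesis using assms(1) unfolding family_space_def by (auto intro!: exI[of _ N])
qed

lemma family_space_add:
  fixes x y :: "nat \<Rightarrow> 'k::real_normed_field"
  assumes "x \<in> family_space" "y \<in> family_space"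
  shows "x + y \<in> family_space"
proof -
  have "\<exists>N. \<forall>S\<in>F. (\<Sum>i\<in>S \<inter> {N<..}. norm ((x + y) i)) \<le> \<epsilon>" if \<epsilon>: "\<epsilon> > 0" for \<epsilon>
  proof -
    obtain M where M: "\<And>S. S \<in> F \<Longrightarrow> (\<Sum>i\<in>S \<inter> {M<..}. norm (x i)) \<le> \<epsilon>/2"
      using family_space_tail[OF assms(1) half_gt_zero[OF \<epsilon>]] by blast
    obtain N where N: "\<And>S. S \<in> F \<Longrightarrow> (\<Sum>i\<in>S \<inter> {N<..}. norm (y i)) \<le> \<epsilon>/2"
      using family_space_tail[OF assms(2) half_gt_zero[OF \<epsilon>]] by blast
    have "(\<Sum>i\<in>S \<inter> {max M N<..}. norm ((x + y) i)) \<le> \<epsilon>" if S: "S \<in> F" for S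
    proof -
      have "(\<Sum>i\<in>S \<inter> {max M N<..}. norm ((x + y) i)) \<le>
          (\<Sum>i\<in>S \<inter> {max M N<..}. norm (x i)) + (\<Sum>i\<in>S \<inter> {max M N<..}. norm (y i))"
        unfolding sum.distrib[symmetric] by (rule sum_mono) (simp add: norm_triangle_ineq)
      also have "\<dots> \<le> (\<Sum>i\<in>S \<inter> {M<..}. norm (x i)) + (\<Sum>i\<in>S \<inter> {N<..}. norm (y i))"
        by (intro add_mono sum_mono2) (use finite_member[OF S] in auto)
      also have "\<dots> \<le> \<epsilon>" using M[OF S] N[OF S] by simp
      finally show ?thesis .
    qed
    then show ?thesis by blast
  qed
  then show ?thesis using assms by (simp add: family_space_def)
qed

lemma family_space_scale:
  fixes x :: "nat \<Rightarrow> 'k::real_normed_field"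
  assumes "x \<in> family_space"
  shows "seq_scale c x \<in> family_space"
proof -
  have "\<exists>N. \<forall>S\<in>F. (\<Sum>i\<in>S \<inter> {N<..}. norm (seq_scale c x i)) \<le> \<epsilon>" if \<epsilon>: "\<epsilon> > 0" for \<epsilon>
  proof -
    have pos: "\<epsilon> / (norm c + 1) > 0" using \<epsilon> by (simp add: add_nonneg_pos)
    obtain N where N: "\<And>S. S \<in> F \<Longrightarrow> (\<Sum>i\<in>S \<inter> {N<..}. norm (x i)) \<le> \<epsilon> / (norm c + 1)"
      using family_space_tail[OF assms pos] by blast
    have "(\<Sum>i\<in>S \<inter> {N<..}. norm (seq_scale c x i)) \<le> \<epsilon>" if S: "S \<in> F" for S
    proof -
      have "(\<Sum>i\<in>S \<inter> {N<..}. norm (seq_scale c x i)) = norm c * (\<Sum>i\<in>S \<inter> {N<..}. norm (x i))"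
        by (simp add: seq_scale_def norm_mult sum_distrib_left)
      also have "\<dots> \<le> (norm c + 1) * (\<Sum>i\<in>S \<inter> {N<..}. norm (x i))"
        by (intro mult_right_mono sum_nonneg) auto
      also have "\<dots> \<le> (norm c + 1) * (\<epsilon> / (norm c + 1))"
        by (intro mult_left_mono N S) auto
      also have "\<dots> = \<epsilon>"
        using norm_ge_zero[of c] by (simp add: add_nonneg_eq_0_iff)
      finally show ?thesis .
    qed
    then show ?thesis by blast
  qed
  then show ?thesis using assms by (simp add: family_space_def seq_scale_def)
qed

lemma unit_seq_in_family_space: "1 \<le> n \<Longrightarrow> unit_seq n \<in> family_space"
  by (rule finite_support_in_family_space[of _ n]) (auto simp: unit_seq_def)

lemma family_norm_unit_seq:
  "1 \<le> n \<Longrightarrow> family_norm (unit_seq n :: nat \<Rightarrow> 'k::real_normed_field) = 1"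
proof (rule antisym)
  show "family_norm (unit_seq n :: nat \<Rightarrow> 'k) \<le> 1" if "1 \<le> n"
  proof (rule family_norm_leI)
    fix S assume "S \<in> F"
    have "(\<Sum>i\<in>S. norm (unit_seq n i :: 'k)) = (\<Sum>i\<in>S. if i = n then 1 else 0)"
      by (rule sum.cong) (auto simp: unit_seq_def)
    then show "(\<Sum>i\<in>S. norm (unit_seq n i :: 'k)) \<le> 1"
      using finite_member[OF \<open>S \<in> F\<close>] by (simp split: if_splits)
  qed
  show "1 \<le> family_norm (unit_seq n :: nat \<Rightarrow> 'k)" if "1 \<le> n"
    using norm_le_family_norm[OF unit_seq_in_family_space[OF that], of n] by (simp add: unit_seq_def)
qed

lemma family_norm_scale:
  fixes x :: "nat \<Rightarrow> 'k::real_normed_field"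
  assumes "x \<in> family_space"
  shows "family_norm (seq_scale c x) = norm c * family_norm x"
proof (rule antisym)
  have mass: "(\<Sum>i\<in>S. norm (seq_scale c x i)) = norm c * (\<Sum>i\<in>S. norm (x i))" for S
    by (simp add: seq_scale_def norm_mult sum_distrib_left)
  show "family_norm (seq_scale c x) \<le> norm c * family_norm x"
    by (rule family_norm_leI) (auto simp: mass intro!: mult_left_mono sum_le_family_norm assms)
  show "norm c * family_norm x \<le> family_norm (seq_scale c x)"
  proof (cases "c = 0")
    case True
    then show ?thesis using family_norm_nonneg[OF family_space_scale[OF assms, of c]] by simp
  next
    case False
    have "family_norm x \<le> family_norm (seq_scale c x) / norm c"
    proof (rule family_norm_leI)
      fix S assume "S \<in> F"
      then have "norm c * (\<Sum>i\<in>S. norm (x i)) \<le> family_norm (seq_scale c x)"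
        using sum_le_family_norm[OF family_space_scale[OF assms]] by (simp flip: mass)
      then show "(\<Sum>i\<in>S. norm (x i)) \<le> family_norm (seq_scale c x) / norm c"
        using False by (simp add: field_simps)
    qed
    then show ?thesis using False by (simp add: field_simps)
  qed
qed

lemma normed_subspace_family_space:
  "normed_subspace seq_scale (family_space :: (nat \<Rightarrow> 'k::real_normed_field) set) family_norm"
proof -
  interpret vector_space "seq_scale :: 'k \<Rightarrow> (nat \<Rightarrow> 'k) \<Rightarrow> (nat \<Rightarrow> 'k)"
    by (rule vector_space_seq_scale)
  have zero: "(0 :: nat \<Rightarrow> 'k) \<in> family_space"
    by (rule finite_support_in_family_space) auto
  show ?thesis
  proof
    show "subspace (family_space :: (nat \<Rightarrow> 'k) set)"
      by (auto simp: subspace_def zero family_space_add family_space_scale)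
    fix x :: "nat \<Rightarrow> 'k" assume x: "x \<in> family_space"
    show "0 \<le> family_norm x" by (rule family_norm_nonneg[OF x])
    show "family_norm x = 0 \<longleftrightarrow> x = 0"
    proof
      assume "family_norm x = 0"
      then show "x = 0" using norm_le_family_norm[OF x] by (auto simp: fun_eq_iff)
    next
      assume "x = 0"
      then show "family_norm x = 0" using family_norm_le_sum[of 0 x] family_norm_nonneg[OF x] by simp
    qed
    show "family_norm (seq_scale c x) = norm c * family_norm x" for c by (rule family_norm_scale[OF x])
    show "family_norm (x + y) \<le> family_norm x + family_norm y" if y: "y \<in> family_space" for y
    proof (rule family_norm_leI)
      fix S assume S: "S \<in> F"
      have "(\<Sum>i\<in>S. norm ((x + y) i)) \<le> (\<Sum>i\<in>S. norm (x i)) + (\<Sum>i\<in>S. norm (y i))"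
        unfolding sum.distrib[symmetric] by (rule sum_mono) (simp add: norm_triangle_ineq)
      then show "(\<Sum>i\<in>S. norm ((x + y) i)) \<le> family_norm x + family_norm y"
        using sum_le_family_norm[OF x S] sum_le_family_norm[OF y S] by linarith
    qed
  qed
qed

lemma family_space_diff: "x \<in> family_space \<Longrightarrow> y \<in> family_space \<Longrightarrow> x - y \<in> family_space"
  for x y :: "nat \<Rightarrow> 'k::real_normed_field"
proof -
  interpret normed_subspace seq_scale "family_space :: (nat \<Rightarrow> 'k) set" family_norm
    by (rule normed_subspace_family_space)
  show "x \<in> family_space \<Longrightarrow> y \<in> family_space \<Longrightarrow> x - y \<in> family_space"
    by (rule subspace_diff[OF subspace_V])
qed

text \<open>
  A Cauchy sequence converges coordinatewise; each sum over a finite set \<open>S \<in> F\<close> passes to this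
  limit, so a Cauchy estimate in norm survives for the pointwise limit with the same bound.
\<close>

lemma mcomplete_family_space:
  "Metric_space.mcomplete (family_space :: (nat \<Rightarrow> 'k::{real_normed_field,banach}) set)
     (normed_subspace.ndist family_space family_norm)"
proof -
  interpret normed_subspace seq_scale "family_space :: (nat \<Rightarrow> 'k) set" family_norm
    by (rule normed_subspace_family_space)
  show "Metric_space.mcomplete (family_space :: (nat \<Rightarrow> 'k) set) ndist"
    unfolding mcomplete_def
  proof (intro allI impI)
    fix \<sigma> :: "nat \<Rightarrow> nat \<Rightarrow> 'k"
    assume cau: "MCauchy \<sigma>"
    then have \<sigma>: "\<sigma> k \<in> family_space" for k by (auto simp: MCauchy_def)
    have diff: "\<sigma> k - \<sigma> l \<in> family_space" for k l by (rule family_space_diff[OF \<sigma> \<sigma>])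
    have close: "\<exists>K. \<forall>k\<ge>K. \<forall>l\<ge>K. family_norm (\<sigma> k - \<sigma> l) < \<epsilon>" if \<epsilon>: "\<epsilon> > 0" for \<epsilon>
      using cau that \<sigma> unfolding MCauchy_def ndist_def by simp
    have "Cauchy (\<lambda>k. \<sigma> k i)" for i
    proof (rule metric_CauchyI)
      fix \<epsilon> :: real assume "\<epsilon> > 0"
      then obtain K where "\<forall>k\<ge>K. \<forall>l\<ge>K. family_norm (\<sigma> k - \<sigma> l) < \<epsilon>" using close by blast
      then show "\<exists>K. \<forall>k\<ge>K. \<forall>l\<ge>K. dist (\<sigma> k i) (\<sigma> l i) < \<epsilon>"
        using norm_le_family_norm[OF diff, of _ _ i] unfolding dist_norm
        by (metis le_less_trans minus_apply)
    qed
    then have "\<exists>l. (\<lambda>k. \<sigma> k i) \<longlonglongrightarrow> l" for i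
      by (simp add: Cauchy_convergent_iff convergent_def)
    then obtain x where lim: "\<And>i. (\<lambda>k. \<sigma> k i) \<longlonglongrightarrow> x i" by metis
    have limit_sum: "(\<Sum>i\<in>T. norm (\<sigma> k i - x i)) \<le> \<epsilon>"
      if K: "\<forall>k\<ge>K. \<forall>l\<ge>K. family_norm (\<sigma> k - \<sigma> l) < \<epsilon>" and k: "k \<ge> K" and S: "S \<in> F" and T: "T \<subseteq> S"
      for K k \<epsilon> S T
    proof (rule tendsto_upperbound)
      show "(\<lambda>l. \<Sum>i\<in>T. norm (\<sigma> k i - \<sigma> l i)) \<longlonglongrightarrow> (\<Sum>i\<in>T. norm (\<sigma> k i - x i))"
        by (intro tendsto_intros lim)
      have "(\<Sum>i\<in>T. norm (\<sigma> k i - \<sigma> l i)) \<le> \<epsilon>" if "l \<ge> K" for l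
      proof -
        have "(\<Sum>i\<in>T. norm (\<sigma> k i - \<sigma> l i)) \<le> (\<Sum>i\<in>S. norm ((\<sigma> k - \<sigma> l) i))"
          using sum_mono2[OF finite_member[OF S] T, of "\<lambda>i. norm (\<sigma> k i - \<sigma> l i)"] by simp
        also have "\<dots> \<le> family_norm (\<sigma> k - \<sigma> l)" by (rule sum_le_family_norm[OF diff S])
        also have "\<dots> \<le> \<epsilon>" using K k that by (simp add: less_imp_le)
        finally show ?thesis .
      qed
      then show "\<forall>\<^sub>F l in sequentially. (\<Sum>i\<in>T. norm (\<sigma> k i - \<sigma> l i)) \<le> \<epsilon>"
        by (auto simp: eventually_sequentially)
    qed simp
    have x: "x \<in> family_space"
    proof -
      have "x 0 = 0"
        using lim[of 0] \<sigma> by (simp add: family_space_def LIMSEQ_const_iff)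
      moreover have "\<exists>N. \<forall>S\<in>F. (\<Sum>i\<in>S \<inter> {N<..}. norm (x i)) \<le> \<epsilon>" if \<epsilon>: "\<epsilon> > 0" for \<epsilon>
      proof -
        obtain K where K: "\<forall>k\<ge>K. \<forall>l\<ge>K. family_norm (\<sigma> k - \<sigma> l) < \<epsilon>/2"
          using close[OF half_gt_zero[OF \<epsilon>]] by auto
        obtain N where N: "\<And>S. S \<in> F \<Longrightarrow> (\<Sum>i\<in>S \<inter> {N<..}. norm (\<sigma> K i)) \<le> \<epsilon>/2"
          using family_space_tail[OF \<sigma> half_gt_zero[OF \<epsilon>]] by blast
        have "(\<Sum>i\<in>S \<inter> {N<..}. norm (x i)) \<le> \<epsilon>" if S: "S \<in> F" for S
        proof -
          have "(\<Sum>i\<in>S \<inter> {N<..}. norm (x i)) \<le>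
              (\<Sum>i\<in>S \<inter> {N<..}. norm (\<sigma> K i)) + (\<Sum>i\<in>S \<inter> {N<..}. norm (\<sigma> K i - x i))"
            unfolding sum.distrib[symmetric]
            by (rule sum_mono) (metis norm_minus_commute norm_triangle_sub)
          then show ?thesis using N[OF S] limit_sum[OF K order_refl S, of "S \<inter> {N<..}"] by simp
        qed
        then show ?thesis by blast
      qed
      ultimately show ?thesis by (simp add: family_space_def)
    qed
    have "limitin mtopology \<sigma> x sequentially"
      unfolding limit_metric_sequentially
    proof (intro conjI allI impI)
      fix \<epsilon> :: real assume "\<epsilon> > 0"
      then obtain K where K: "\<forall>k\<ge>K. \<forall>l\<ge>K. family_norm (\<sigma> k - \<sigma> l) < \<epsilon>/2"
        using close[of "\<epsilon>/2"] by auto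
      have "family_norm (\<sigma> k - x) \<le> \<epsilon>/2" if "k \<ge> K" for k
        by (rule family_norm_leI) (use limit_sum[OF K that _ order_refl] in simp)
      then show "\<exists>K. \<forall>k\<ge>K. \<sigma> k \<in> family_space \<and> ndist (\<sigma> k) x < \<epsilon>"
        using \<open>\<epsilon> > 0\<close> \<sigma> x by (fastforce simp: ndist_def)
    qed (rule x)
    then show "\<exists>x. limitin mtopology \<sigma> x sequentially" by blast
  qed
qed

text \<open>
  The coefficients are taken from an arbitrary dense set \<open>D\<close>, in order that \<open>D = UNIV\<close> gives density
  of the linear span and a countable \<open>D\<close> gives separability.
\<close>

lemma finitely_supported_dense:
  fixes x :: "nat \<Rightarrow> 'k::real_normed_field" and D :: "'k set"
  assumes D: "\<And>U. open U \<Longrightarrow> U \<noteq> {} \<Longrightarrow> \<exists>d\<in>D. d \<in> U"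
    and x: "x \<in> family_space" and "r > 0"
  shows "\<exists>N a. (\<forall>i. a i \<in> D) \<and>
    family_norm (x - (\<Sum>n=1..N. seq_scale (a n) (unit_seq n))) < r"
proof -
  obtain N where N: "\<And>S. S \<in> F \<Longrightarrow> (\<Sum>i\<in>S \<inter> {N<..}. norm (x i)) \<le> r/3"
    using family_space_tail[OF x, of "r/3"] \<open>r > 0\<close> by auto
  \<comment> \<open>The error in the first \<open>N\<close> coordinates then adds up to at most \<open>r/3\<close>.\<close>
  define \<eta> where "\<eta> = r / (3 * (real N + 1))"
  have "\<eta> > 0" using \<open>r > 0\<close> by (simp add: \<eta>_def)
  have "\<exists>d\<in>D. d \<in> ball (x i) \<eta>" for i
    by (rule D) (use \<open>\<eta> > 0\<close> in auto)
  then obtain a where a: "\<And>i. a i \<in> D" "\<And>i. dist (x i) (a i) < \<eta>"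
    by (metis mem_ball)
  let ?y = "\<Sum>n=1..N. seq_scale (a n) (unit_seq n) :: nat \<Rightarrow> 'k"
  have y: "?y i = (if i \<in> {1..N} then a i else 0)" for i
    by (rule sum_unit_seq_apply) simp
  have "family_norm (x - ?y) \<le> 2 * r / 3"
  proof (rule family_norm_leI)
    fix S assume S: "S \<in> F"
    have "(\<Sum>i\<le>N. norm ((x - ?y) i)) \<le> (\<Sum>i\<le>N. \<eta>)"
    proof (rule sum_mono)
      fix i assume "i \<in> {..N}"
      then show "norm ((x - ?y) i) \<le> \<eta>"
        using a(2)[of i] \<open>\<eta> > 0\<close> x y[of i]
        by (cases "i = 0") (auto simp: family_space_def dist_norm simp del: One_nat_def)
    qed
    also have "\<dots> = r / 3" by (simp add: \<eta>_def field_simps)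
    finally have head: "(\<Sum>i\<le>N. norm ((x - ?y) i)) \<le> r / 3" .
    have "(\<Sum>i\<in>S \<inter> {N<..}. norm ((x - ?y) i)) = (\<Sum>i\<in>S \<inter> {N<..}. norm (x i))"
      by (rule sum.cong) (auto simp: y simp del: One_nat_def)
    then show "(\<Sum>i\<in>S. norm ((x - ?y) i)) \<le> 2 * r / 3"
      using sum_split_at[OF S, of "x - ?y" N] head N[OF S] by simp
  qed
  with \<open>r > 0\<close> a(1) show ?thesis by (intro exI[of _ N] exI[of _ a]) simp
qed

section \<open>The coordinate basis\<close>

lemma coordinate_basis:
  "banach_basis seq_scale
     (family_space :: (nat \<Rightarrow> 'k::{real_normed_field,banach,second_countable_topology}) set)
     family_norm unit_seq (\<lambda>n x. x n)"
proof -
  interpret normed_subspace seq_scale "family_space :: (nat \<Rightarrow> 'k) set" family_norm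
    by (rule normed_subspace_family_space)
  let ?lin = "\<lambda>N (a :: nat \<Rightarrow> 'k). \<Sum>n=1..N. seq_scale (a n) (unit_seq n)"
  have lin_span: "?lin N a \<in> span (unit_seq ` {1..})" for N a
    by (intro span_sum span_scale span_base) auto
  have span_sub: "span (unit_seq ` {1..}) \<subseteq> (family_space :: (nat \<Rightarrow> 'k) set)"
    by (rule span_minimal[OF _ subspace_V]) (use unit_seq_in_family_space in auto)
  have lin_space: "?lin N a \<in> family_space" for N a
    using lin_span span_sub by blast
  have dense: "mtopology closure_of T = (family_space :: (nat \<Rightarrow> 'k) set)"
    if D: "\<And>U :: 'k set. open U \<Longrightarrow> U \<noteq> {} \<Longrightarrow> \<exists>d\<in>D. d \<in> U"
      and T: "\<And>N a. (\<And>i. a i \<in> D) \<Longrightarrow> ?lin N a \<in> T" for T D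
  proof -
    have "\<exists>y\<in>T. y \<in> mball x r" if x: "x \<in> family_space" and r: "r > 0" for x :: "nat \<Rightarrow> 'k" and r
    proof -
      obtain N a where a: "\<And>i. a i \<in> D" and "family_norm (x - ?lin N a) < r"
        using finitely_supported_dense[OF D x r] by blast
      then have "?lin N a \<in> mball x r"
        using x lin_space unfolding in_mball ndist_def by simp
      moreover have "?lin N a \<in> T" using a by (rule T)
      ultimately show ?thesis by blast
    qed
    then show ?thesis unfolding metric_closure_of by blast
  qed
  have separable: "separable_space mtopology"
  proof -
    obtain D :: "'k set" where "countable D"
      and D: "\<And>U. open U \<Longrightarrow> U \<noteq> {} \<Longrightarrow> \<exists>d\<in>D. d \<in> U"
      using countable_dense_setE by blast
    \<comment> \<open>A list over \<open>D\<close> holds the coefficients of a finite linear combination.\<close>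
    define comb :: "'k list \<Rightarrow> nat \<Rightarrow> 'k"
      where "comb as = ?lin (length as) (\<lambda>n. as ! (n - 1))" for as
    have "?lin N a \<in> comb ` lists D" if "\<And>i. a i \<in> D" for N a
    proof
      show "?lin N a = comb (map a [1..<Suc N])"
        unfolding comb_def by (rule sum.cong) (auto simp del: upt_Suc)
    qed (use that in auto)
    then have "mtopology closure_of (comb ` lists D) = family_space"
      using dense[OF D] by blast
    moreover have "countable (comb ` lists D)"
      using \<open>countable D\<close> by simp
    moreover have "comb ` lists D \<subseteq> family_space"
      using lin_space by (auto simp: comb_def simp del: One_nat_def)
    ultimately show ?thesis
      unfolding separable_space_def topspace_mtopology by blast
  qed
  \<comment> \<open>The unit sequences are independent: coordinate \<open>n\<close> vanishes on the span of all but the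
    \<open>n\<close>-th.\<close>
  have inf_dim: "\<nexists>S. finite S \<and> span S = (family_space :: (nat \<Rightarrow> 'k) set)"
  proof
    assume "\<exists>S. finite S \<and> span S = (family_space :: (nat \<Rightarrow> 'k) set)"
    then obtain S :: "(nat \<Rightarrow> 'k) set" where S: "finite S" "span S = family_space" by blast
    have inj: "inj_on (unit_seq :: nat \<Rightarrow> nat \<Rightarrow> 'k) {1..}"
      by (rule inj_onI) (metis unit_seq_def zero_neq_one)
    have "independent ((unit_seq :: nat \<Rightarrow> nat \<Rightarrow> 'k) ` {1..})"
      unfolding dependent_def
    proof (intro notI, elim bexE)
      fix v :: "nat \<Rightarrow> 'k"
      assume "v \<in> unit_seq ` {1..}" and v: "v \<in> span (unit_seq ` {1..} - {v})"
      then obtain n where n: "v = unit_seq n" by blast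
      have sub: "unit_seq ` {1..} - {v} \<subseteq> {x. x n = 0}" by (auto simp: n unit_seq_def)
      have "subspace {x :: nat \<Rightarrow> 'k. x n = 0}"
        by (auto simp: subspace_def seq_scale_def)
      then have "v \<in> {x. x n = 0}"
        by (rule subsetD[OF span_minimal[OF sub] v])
      then show False by (simp add: n unit_seq_def)
    qed
    moreover have "unit_seq ` {1..} \<subseteq> span S"
      unfolding S(2) by (rule order_trans[OF span_superset span_sub])
    ultimately have "finite ((unit_seq :: nat \<Rightarrow> nat \<Rightarrow> 'k) ` {1..})"
      using independent_span_bound[OF S(1)] by blast
    then show False using finite_imageD[OF _ inj] infinite_Ici by blast
  qed
  have dual_norm: "dual_norm (\<lambda>x. x n) = 1" if "1 \<le> n" for n
    unfolding dual_norm_def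
  proof (rule cSup_eq_maximum)
    have one: "(1::real) = norm (unit_seq n n :: 'k)" by (simp add: unit_seq_def)
    show "1 \<in> {norm (x n) |x :: nat \<Rightarrow> 'k. x \<in> family_space \<and> family_norm x \<le> 1}"
      unfolding mem_Collect_eq
      by (intro exI[of _ "unit_seq n"] conjI, rule one)
        (simp_all add: unit_seq_in_family_space[OF that] family_norm_unit_seq[OF that])
    show "c \<le> 1" if "c \<in> {norm (x n) |x :: nat \<Rightarrow> 'k. x \<in> family_space \<and> family_norm x \<le> 1}" for c
      using that norm_le_family_norm order_trans by blast
  qed
  show ?thesis
  proof
    show mcomplete by (rule mcomplete_family_space)
    show "separable_space mtopology" by (rule separable)
    show "\<nexists>S. finite S \<and> span S = (family_space :: (nat \<Rightarrow> 'k) set)" by (rule inf_dim)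
    show "mtopology closure_of span (unit_seq ` {1..}) = (family_space :: (nat \<Rightarrow> 'k) set)"
      by (rule dense[of UNIV]) (use lin_span in auto)
    show "continuous_functional (\<lambda>x :: nat \<Rightarrow> 'k. x n)" for n
      unfolding continuous_functional_def
      by (auto simp: seq_scale_def intro!: exI[of _ 1] norm_le_family_norm)
    show "\<exists>c>0. \<exists>C. \<forall>n\<ge>1. c \<le> family_norm (unit_seq n :: nat \<Rightarrow> 'k) \<and>
        family_norm (unit_seq n :: nat \<Rightarrow> 'k) \<le> C \<and>
        c \<le> dual_norm (\<lambda>x. x n) \<and> dual_norm (\<lambda>x. x n) \<le> C"
      by (intro exI[of _ 1] conjI allI impI) (simp_all add: family_norm_unit_seq dual_norm)
  qed (auto simp: unit_seq_in_family_space, auto simp: unit_seq_def)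
qed

lemma one_unconditional_coordinate_basis:
  "banach_basis.one_unconditional seq_scale family_norm
     (unit_seq :: nat \<Rightarrow> nat \<Rightarrow> 'k::{real_normed_field,banach,second_countable_topology})"
proof -
  interpret banach_basis seq_scale "family_space :: (nat \<Rightarrow> 'k) set" family_norm unit_seq "\<lambda>n x. x n"
    by (rule coordinate_basis)
  show ?thesis
    unfolding one_unconditional_def
  proof (intro allI impI)
    fix N and a b :: "nat \<Rightarrow> 'k"
    assume le: "\<forall>n\<in>{1..N}. norm (a n) \<le> norm (b n)"
    have "(\<Sum>n=1..N. seq_scale (b n) (unit_seq n)) \<in> family_space"
      by (rule finite_support_in_family_space[of _ N])
        (auto simp: sum_unit_seq_apply simp del: One_nat_def)
    then show "family_norm (\<Sum>n=1..N. seq_scale (a n) (unit_seq n)) \<le>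
        family_norm (\<Sum>n=1..N. seq_scale (b n) (unit_seq n))"
      by (rule family_norm_mono) (use le in \<open>simp add: sum_unit_seq_apply\<close>)
  qed
qed

text \<open>
  The PSLC property becomes a combinatorial property of \<open>F\<close>, with \<open>T\<close> in the role of the support
  of \<open>x\<close>. The order condition makes \<open>A\<close> disjoint from \<open>T\<close>, so the sum of \<open>x + 1\<^bsub>\<epsilon>A\<^esub>\<close> over \<open>S\<close> is the
  sum of \<open>\<bar>x\<bar>\<close> over \<open>S \<inter> T\<close> plus the number of points of \<open>A\<close> in \<open>S\<close>. It suffices that some
  \<open>S' \<in> F\<close> keeps \<open>S \<inter> T\<close> and catches as many points of \<open>B\<close>.
\<close>

lemma one_PSLC_coordinate_basis:
  fixes ns :: "nat \<Rightarrow> nat"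
  assumes pos: "\<And>k. 0 < ns k"
    and exchange: "\<And>S A B T.
    \<lbrakk>S \<in> F; finite A; A \<subseteq> range ns; finite B; B \<subseteq> {1..}; card A \<le> card B; B \<inter> T = {};
      \<forall>a\<in>A. \<forall>b\<in>(B \<union> T) \<inter> range ns. a < b\<rbrakk>
    \<Longrightarrow> \<exists>S'\<in>F. S \<inter> T \<subseteq> S' \<and> card (S \<inter> A) \<le> card (S' \<inter> B)"
  shows "banach_basis.one_PSLC seq_scale
     (family_space :: (nat \<Rightarrow> 'k::{real_normed_field,banach,second_countable_topology}) set)
     family_norm unit_seq (\<lambda>n x. x n) ns"
proof -
  interpret banach_basis seq_scale "family_space :: (nat \<Rightarrow> 'k) set" family_norm unit_seq "\<lambda>n x. x n"
    by (rule coordinate_basis)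
  have mass: "(\<Sum>i\<in>S. norm ((x + signed_indicator \<epsilon> A) i)) =
      (\<Sum>i\<in>S \<inter> supp x. norm (x i)) + card (S \<inter> A)"
    if S: "S \<in> F" and x: "x \<in> family_space" and A: "finite A" "A \<subseteq> {1..}" "A \<inter> supp x = {}"
      and \<epsilon>: "sign \<epsilon>" for S A x \<epsilon>
  proof -
    have "norm ((x + signed_indicator \<epsilon> A) i) =
        (if i \<in> supp x then norm (x i) else 0) + (if i \<in> A then 1 else 0)" for i
    proof (cases "i \<in> A")
      case True
      then have "1 \<le> i" "i \<notin> supp x" using A by auto
      then have "x i = 0" "norm (\<epsilon> i) = 1" using \<epsilon> by (simp_all add: supp_def sign_def)
      then show ?thesis using True \<open>i \<notin> supp x\<close> A(1) by (simp add: signed_indicator_def sum_unit_seq_apply)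
    next
      case False
      have "x i = 0" if "i \<notin> supp x"
        using x that by (cases "i = 0") (auto simp: supp_def family_space_def)
      then show ?thesis using False A(1) by (auto simp: signed_indicator_def sum_unit_seq_apply)
    qed
    moreover have "(\<Sum>i\<in>S. if i \<in> A then 1 else 0) = real (card (S \<inter> A))"
      using sum.inter_restrict[OF finite_member[OF S], of "\<lambda>_. 1::real" A] by simp
    ultimately show ?thesis
      by (simp only: sum.distrib sum.inter_restrict[OF finite_member[OF S], of "\<lambda>i. norm (x i)"])
  qed
  show ?thesis
    unfolding one_PSLC_def
  proof (intro ballI allI impI, elim conjE)
    fix x :: "nat \<Rightarrow> 'k" and A B and \<epsilon> \<delta> :: "nat \<Rightarrow> 'k"
    assume x: "x \<in> family_space"
      and A: "finite A" "A \<subseteq> range ns" and B: "finite B" "B \<subseteq> {1..}"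
      and card: "card A \<le> card B" and disj: "B \<inter> supp x = {}"
      and less: "set_less A ((B \<union> supp x) \<inter> range ns)" and \<epsilon>: "sign \<epsilon>" and \<delta>: "sign \<delta>"
    show "family_norm (x + signed_indicator \<epsilon> A) \<le> family_norm (x + signed_indicator \<delta> B)"
    proof (rule family_norm_leI)
      fix S assume S: "S \<in> F"
      have A1: "A \<subseteq> {1..}" using A(2) pos by (auto simp: Suc_le_eq)
      have A_disj: "A \<inter> supp x = {}"
        using A(2) less unfolding set_less_def by blast
      obtain S' where S': "S' \<in> F" "S \<inter> supp x \<subseteq> S'" "card (S \<inter> A) \<le> card (S' \<inter> B)"
        using exchange[OF S A B card disj] less unfolding set_less_def by blast
      have "signed_indicator \<delta> B \<in> family_space"
        unfolding signed_indicator_def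
        by (rule finite_support_in_family_space[of _ "Max B"])
          (use B in \<open>auto simp: sum_unit_seq_apply dest: Max_ge\<close>)
      then have mem: "x + signed_indicator \<delta> B \<in> family_space"
        by (rule family_space_add[OF x])
      have "(\<Sum>i\<in>S. norm ((x + signed_indicator \<epsilon> A) i)) =
          (\<Sum>i\<in>S \<inter> supp x. norm (x i)) + card (S \<inter> A)"
        by (rule mass[OF S x A(1) A1 A_disj \<epsilon>])
      also have "\<dots> \<le> (\<Sum>i\<in>S' \<inter> supp x. norm (x i)) + card (S' \<inter> B)"
        by (intro add_mono sum_mono2) (use S' finite_member in auto)
      also have "\<dots> = (\<Sum>i\<in>S'. norm ((x + signed_indicator \<delta> B) i))"
        by (rule mass[OF S'(1) x B disj \<delta>, symmetric])
      also have "\<dots> \<le> family_norm (x + signed_indicator \<delta> B)"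
        by (rule sum_le_family_norm[OF mem S'(1)])
      finally show "(\<Sum>i\<in>S. norm ((x + signed_indicator \<epsilon> A) i)) \<le>
          family_norm (x + signed_indicator \<delta> B)" .
    qed
  qed
qed

text \<open>
  A member \<open>A\<close> of \<open>F\<close> has \<open>\<parallel>1\<^sub>A\<parallel> = card A\<close>, whereas \<open>\<parallel>1\<^sub>B\<parallel>\<close> is at most the largest intersection
  of \<open>B\<close> with members of \<open>F\<close>.
\<close>

lemma not_conservative_coordinate_basis:
  fixes ms :: "nat \<Rightarrow> nat"
  assumes pos: "\<And>k. 0 < ms k"
    and witness: "\<And>C. \<exists>A\<in>F. \<exists>B t. A \<subseteq> range ms \<and> finite B \<and> B \<subseteq> {1..} \<and>
      card A \<le> card B \<and> (\<forall>a\<in>A. \<forall>b\<in>B \<inter> range ms. a < b) \<and>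
      (\<forall>S\<in>F. real (card (S \<inter> B)) \<le> t) \<and> C * t < real (card A)"
  shows "\<not> banach_basis.conservative family_norm
     (unit_seq :: nat \<Rightarrow> nat \<Rightarrow> 'k::{real_normed_field,banach,second_countable_topology}) ms"
proof -
  interpret banach_basis seq_scale "family_space :: (nat \<Rightarrow> 'k) set" family_norm unit_seq "\<lambda>n x. x n"
    by (rule coordinate_basis)
  have indicator_apply: "indicator_vec A i = (if i \<in> A then 1 else 0)" if "finite A" for A i
    using that by (simp add: indicator_vec_def sum_fun_apply unit_seq_def)
  have mass: "(\<Sum>i\<in>S. norm (indicator_vec A i)) = card (S \<inter> A)"
    if "S \<in> F" "finite A" for S A
    using that finite_member[of S] by (simp add: indicator_apply if_distrib sum.If_cases cong: if_cong)
  show ?thesis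
    unfolding conservative_def
  proof (intro notI, elim exE conjE)
    fix C :: real
    assume "C > 0" and C: "\<forall>A B. finite A \<and> A \<subseteq> range ms \<and> finite B \<and> B \<subseteq> {1..} \<and>
      card A \<le> card B \<and> set_less A (B \<inter> range ms) \<longrightarrow>
      family_norm (indicator_vec A) \<le> C * family_norm (indicator_vec B)"
    obtain A B t where A: "A \<in> F" "A \<subseteq> range ms" and B: "finite B" "B \<subseteq> {1..}"
      and card: "card A \<le> card B" and less: "\<forall>a\<in>A. \<forall>b\<in>B \<inter> range ms. a < b"
      and t: "\<forall>S\<in>F. real (card (S \<inter> B)) \<le> t" and big: "C * t < real (card A)"
      using witness[of C] by blast
    have A1: "A \<subseteq> {1..}" using A(2) pos by (auto simp: Suc_le_eq)
    have finA: "finite A" by (rule finite_member[OF A(1)])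
    have "indicator_vec A \<in> family_space"
      by (rule finite_support_in_family_space[of _ "Max A"])
        (use finA A1 in \<open>auto simp: indicator_apply dest: Max_ge\<close>)
    then have "real (card A) \<le> family_norm (indicator_vec A)"
      using sum_le_family_norm[OF _ A(1)] mass[OF A(1) finA] by fastforce
    also have "\<dots> \<le> C * family_norm (indicator_vec B)"
      using C finA A(2) B card less by (simp add: set_less_def)
    also have "\<dots> \<le> C * t"
      by (intro mult_left_mono family_norm_leI) (use mass B t \<open>C > 0\<close> in auto)
    finally show False using big by simp
  qed
qed

end

lemma (in banach_basis) democratic_imp_conservative:
  assumes "democratic" and "\<And>k. 0 < ms k"
  shows "conservative ms"
proof -
  obtain C where "C \<ge> 1" and C: "\<forall>A B.
      finite A \<and> A \<subseteq> {1..} \<and> finite B \<and> B \<subseteq> {1..} \<and> card A \<le> card B \<longrightarrow>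
      nrm (indicator_vec A) \<le> C * nrm (indicator_vec B)"
    using assms(1) unfolding democratic_def by blast
  have "range ms \<subseteq> {1..}" using assms(2) by (auto simp: Suc_le_eq)
  then show ?thesis
    unfolding conservative_def using C \<open>C \<ge> 1\<close>
    by (intro exI[of _ C]) (auto intro: order_trans)
qed

section \<open>Families with bounded trace\<close>

text \<open>
  On \<open>N\<close> this is a Schreier-type condition, for nondecreasing \<open>f\<close> the same as
  \<open>card (S \<inter> N) \<le> f (Min (S \<inter> N))\<close> when \<open>S \<inter> N\<close> is nonempty; off \<open>N\<close> the set \<open>S\<close> is free.
  The resulting space is the \<open>\<ell>\<^sub>1\<close>-sum of an \<open>\<ell>\<^sub>1\<close> off \<open>N\<close> with a space of Schreier type on \<open>N\<close>.
\<close>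

definition bounded_trace_family :: "(nat \<Rightarrow> nat) \<Rightarrow> nat set \<Rightarrow> nat set set"
  where "bounded_trace_family f N = {S. finite S \<and> (\<forall>i\<in>S \<inter> N. card (S \<inter> N) \<le> f i)}"

lemma norming_family_bounded_trace:
  assumes "\<And>i. 1 \<le> f i"
  shows "norming_family (bounded_trace_family f N)"
proof
  show "{i} \<in> bounded_trace_family f N" for i
  proof (cases "i \<in> N")
    case True then show ?thesis using assms[of i] by (simp add: bounded_trace_family_def)
  next
    case False then show ?thesis by (simp add: bounded_trace_family_def)
  qed
qed (simp add: bounded_trace_family_def)

text \<open>
  Replace the points of \<open>A\<close> in \<open>S\<close> by as many points of \<open>B\<close>. Points of \<open>A\<close> all count
  towards the trace on \<open>N\<close>, so the trace does not grow; and by the order condition the new trace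
  consists of points beyond \<open>A\<close>, where the monotone bound \<open>f\<close> is no stricter.
\<close>

lemma bounded_trace_exchange:
  assumes f: "mono f"
    and S: "S \<in> bounded_trace_family f N" and A: "finite A" "A \<subseteq> N" and B: "finite B"
    and card: "card A \<le> card B" and disj: "B \<inter> T = {}"
    and less: "\<forall>a\<in>A. \<forall>b\<in>(B \<union> T) \<inter> N. a < b"
  shows "\<exists>S'\<in>bounded_trace_family f N. S \<inter> T \<subseteq> S' \<and> card (S \<inter> A) \<le> card (S' \<inter> B)"
proof -
  have S_bound: "card (S \<inter> N) \<le> f i" if "i \<in> S \<inter> N" for i
    using S that by (auto simp: bounded_trace_family_def)
  have finS: "finite S" using S by (simp add: bounded_trace_family_def)
  have "card (S \<inter> A) \<le> card B"
    using card card_mono[OF A(1), of "S \<inter> A"] by simp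
  then obtain B' where B': "B' \<subseteq> B" "card B' = card (S \<inter> A)"
    by (meson obtain_subset_with_card_n)
  have finB': "finite B'" using B B'(1) finite_subset by blast
  define S' where "S' = (S \<inter> T) \<union> B'"
  have AT: "A \<inter> T = {}" using A(2) less by blast
  have "card (S' \<inter> N) \<le> f i" if i: "i \<in> S' \<inter> N" for i
  proof -
    have "card (S' \<inter> N) \<le> card (S \<inter> T \<inter> N) + card B'"
    proof -
      have "S' \<inter> N \<subseteq> (S \<inter> T \<inter> N) \<union> B'" by (auto simp: S'_def)
      then have "card (S' \<inter> N) \<le> card ((S \<inter> T \<inter> N) \<union> B')"
        using finS finB' by (intro card_mono) auto
      then show ?thesis using card_Un_le order_trans by blast
    qed
    also have "\<dots> = card ((S \<inter> T \<inter> N) \<union> (S \<inter> A))"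
      unfolding B'(2) using finS AT by (intro card_Un_disjoint[symmetric]) auto
    also have "\<dots> \<le> card (S \<inter> N)"
      using finS A(2) by (intro card_mono) auto
    finally have le: "card (S' \<inter> N) \<le> card (S \<inter> N)" .
    show ?thesis
      \<comment> \<open>If nothing is replaced, \<open>i\<close> already lies in \<open>S\<close>; otherwise \<open>i\<close> exceeds a point of
        \<open>S \<inter> A\<close>, whose bound is inherited.\<close>
    proof (cases "S \<inter> A = {}")
      case True
      then have "B' = {}" using B'(2) finB' by simp
      then show ?thesis using le S_bound[of i] i by (auto simp: S'_def)
    next
      case False
      then obtain a where a: "a \<in> S \<inter> A" by blast
      then have "a < i" using less i B'(1) by (auto simp: S'_def)
      then have "f a \<le> f i" using f by (simp add: monoD)
      then show ?thesis using le S_bound[of a] a A(2) by fastforce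
    qed
  qed
  then have "S' \<in> bounded_trace_family f N"
    using finS finB' by (auto simp: bounded_trace_family_def S'_def)
  moreover have "card (S \<inter> A) \<le> card (S' \<inter> B)"
    unfolding B'(2)[symmetric] using B'(1) B by (intro card_mono) (auto simp: S'_def)
  ultimately show ?thesis by (auto simp: S'_def)
qed

lemma card_inter_bounded_trace:
  assumes "S \<in> bounded_trace_family f N" "B \<subseteq> N" "\<And>b. b \<in> B \<Longrightarrow> f b \<le> t"
  shows "card (S \<inter> B) \<le> t"
proof (cases "S \<inter> B = {}")
  case False
  then obtain b where b: "b \<in> S \<inter> B" by blast
  have "card (S \<inter> B) \<le> card (S \<inter> N)"
    using assms(1,2) by (intro card_mono) (auto simp: bounded_trace_family_def)
  also have "\<dots> \<le> f b" using assms(1,2) b by (auto simp: bounded_trace_family_def)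
  also have "\<dots> \<le> t" using assms(3) b by blast
  finally show ?thesis .
qed simp

section \<open>Failure of conservativity\<close>

lemma infinite_nat_obtains_far_subset:
  fixes D :: "nat set"
  assumes "infinite D"
  obtains A where "A \<subseteq> D" "finite A" "card A = k" "\<And>a. a \<in> A \<Longrightarrow> j < a"
proof -
  have "infinite (D - {..j})" using assms by simp
  then obtain A where "finite A" "card A = k" "A \<subseteq> D - {..j}"
    using infinite_arbitrarily_large by blast
  then show ?thesis by (intro that[of A]) auto
qed

lemma infinite_nat_card_atMost:
  fixes D :: "nat set"
  assumes "infinite D"
  shows "\<exists>j. k \<le> card (D \<inter> {..j})"
proof -
  obtain A where A: "finite A" "card A = k" "A \<subseteq> D"
    using infinite_arbitrarily_large[OF assms] by blast
  have "A \<subseteq> D \<inter> {..Max A}" using A Max_ge by auto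
  then show ?thesis using card_mono[of "D \<inter> {..Max A}" A] A(2) by auto
qed

text \<open>
  With the constant bound \<open>1\<close> the norm is the sum of the sup norm on \<open>N\<close> and the \<open>\<ell>\<^sub>1\<close>-norm
  off \<open>N\<close>. Hence the indicator of a set in \<open>M - N\<close> has norm equal to its size, whereas for a
  set in \<open>N\<close>, which can be pushed beyond it, the norm is \<open>1\<close>.
\<close>

lemma trace_one_witness:
  fixes M N :: "nat set" and C :: real
  assumes MN: "infinite (M - N)" and N: "infinite N" "N \<subseteq> {1..}"
  shows "\<exists>A\<in>bounded_trace_family (\<lambda>_. 1) N. \<exists>B t. A \<subseteq> M \<and> finite B \<and> B \<subseteq> {1..} \<and>
      card A \<le> card B \<and> (\<forall>a\<in>A. \<forall>b\<in>B \<inter> M. a < b) \<and>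
      (\<forall>S\<in>bounded_trace_family (\<lambda>_. 1) N. real (card (S \<inter> B)) \<le> t) \<and> C * t < real (card A)"
proof -
  obtain k :: nat where k: "C < real k" using reals_Archimedean2 by blast
  obtain A where A: "A \<subseteq> M - N" "finite A" "card A = k"
    using infinite_nat_obtains_far_subset[OF MN] by metis
  obtain B where B: "B \<subseteq> N" "finite B" "card B = k" "\<And>b. b \<in> B \<Longrightarrow> Max A < b"
    using infinite_nat_obtains_far_subset[OF N(1)] by metis
  have "A \<in> bounded_trace_family (\<lambda>_. 1) N"
    using A by (auto simp: bounded_trace_family_def)
  moreover have "\<forall>a\<in>A. \<forall>b\<in>B \<inter> M. a < b"
    using A(2) B(4) by (meson IntD1 Max_ge le_less_trans)
  moreover have "\<forall>S\<in>bounded_trace_family (\<lambda>_. 1) N. real (card (S \<inter> B)) \<le> 1"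
    using card_inter_bounded_trace[OF _ B(1), of _ "\<lambda>_. 1" 1] by simp
  moreover have "C * 1 < real (card A)" using k A(3) by simp
  moreover have "A \<subseteq> M" "B \<subseteq> {1..}" "card A \<le> card B" using A B N by auto
  ultimately show ?thesis using B(2) by blast
qed

lemma mono_slow_trace:
  fixes D :: "nat set"
  shows "mono (\<lambda>j. 1 + nat \<lfloor>sqrt (card (D \<inter> {..j}))\<rfloor>)"
proof (rule monoI)
  fix i j :: nat assume "i \<le> j"
  then have "card (D \<inter> {..i}) \<le> card (D \<inter> {..j})" by (intro card_mono) auto
  then show "1 + nat \<lfloor>sqrt (card (D \<inter> {..i}))\<rfloor> \<le> 1 + nat \<lfloor>sqrt (card (D \<inter> {..j}))\<rfloor>"
    by (intro add_left_mono nat_mono floor_mono) simp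
qed

text \<open>
  Now the short set \<open>B \<subseteq> N - M\<close> comes first: missing \<open>M\<close>, it puts no restriction on the position
  of \<open>A\<close>. The bound \<open>f\<close> grows like the square root of the counting function of \<open>N - M\<close>, so that
  the first \<open>k\<close> points of \<open>N - M\<close> have an indicator of norm at most \<open>1 + sqrt k\<close>, however sparse
  \<open>N - M\<close> is. But \<open>f\<close> is unbounded, so any \<open>k\<close> points of \<open>M\<close> that lie far enough out form a
  member of the family. The summand \<open>1\<close> keeps the singletons in the family.
\<close>

lemma slow_trace_witness:
  fixes M N :: "nat set" and C :: real
  defines "f \<equiv> \<lambda>j. 1 + nat \<lfloor>sqrt (card ((N - M) \<inter> {..j}))\<rfloor>"
  assumes NM: "infinite (N - M)" and N: "N \<subseteq> {1..}" and M: "infinite M"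
  shows "\<exists>A\<in>bounded_trace_family f N. \<exists>B t. A \<subseteq> M \<and> finite B \<and> B \<subseteq> {1..} \<and>
      card A \<le> card B \<and> (\<forall>a\<in>A. \<forall>b\<in>B \<inter> M. a < b) \<and>
      (\<forall>S\<in>bounded_trace_family f N. real (card (S \<inter> B)) \<le> t) \<and> C * t < real (card A)"
proof -
  let ?D = "N - M"
  \<comment> \<open>With \<open>s = sqrt (card B)\<close>, having \<open>s \<ge> 2 * \<bar>C\<bar> + 1\<close> forces \<open>C * (1 + s) < s * s\<close>.\<close>
  obtain j where j: "nat \<lceil>(2 * \<bar>C\<bar> + 1)\<^sup>2\<rceil> \<le> card (?D \<inter> {..j})"
    using infinite_nat_card_atMost[OF NM] by blast
  define B where "B = ?D \<inter> {..j}"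
  define s where "s = sqrt (card B)"
  have "(2 * \<bar>C\<bar> + 1)\<^sup>2 \<le> card B"
    using j by (simp add: B_def nat_le_iff ceiling_le_iff)
  then have s: "2 * \<bar>C\<bar> + 1 \<le> s" unfolding s_def by (rule real_le_rsqrt)
  have fj: "real (f j) \<le> 1 + s" by (simp add: f_def s_def B_def)
  have f_mono: "mono f" unfolding f_def by (rule mono_slow_trace)
  \<comment> \<open>Beyond \<open>j'\<close> the bound \<open>f\<close> admits every set of \<open>card B\<close> points.\<close>
  obtain j' where j': "(card B)\<^sup>2 \<le> card (?D \<inter> {..j'})"
    using infinite_nat_card_atMost[OF NM] by blast
  have "real (card B) \<le> sqrt (card (?D \<inter> {..j'}))"
    by (rule real_le_rsqrt) (use j' in \<open>simp flip: of_nat_power\<close>)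
  then have fj': "card B \<le> f j'" by (simp add: f_def le_nat_iff le_floor_iff le_SucI)
  obtain A where A: "A \<subseteq> M" "finite A" "card A = card B" "\<And>a. a \<in> A \<Longrightarrow> j' < a"
    using infinite_nat_obtains_far_subset[OF M] by metis
  have "card (A \<inter> N) \<le> f i" if "i \<in> A" for i
  proof -
    have "card (A \<inter> N) \<le> card B" using A(2) by (simp add: card_mono flip: A(3))
    also have "\<dots> \<le> f i" using fj' monoD[OF f_mono, of j' i] A(4)[OF that] by simp
    finally show ?thesis .
  qed
  then have "A \<in> bounded_trace_family f N"
    using A(2) by (simp add: bounded_trace_family_def)
  moreover have "\<forall>a\<in>A. \<forall>b\<in>B \<inter> M. a < b" by (auto simp: B_def)
  moreover have "\<forall>S\<in>bounded_trace_family f N. real (card (S \<inter> B)) \<le> 1 + s"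
  proof
    fix S assume "S \<in> bounded_trace_family f N"
    then have "card (S \<inter> B) \<le> f j"
      by (rule card_inter_bounded_trace) (auto simp: B_def intro: monoD[OF f_mono])
    then show "real (card (S \<inter> B)) \<le> 1 + s" using fj by linarith
  qed
  moreover have "C * (1 + s) < real (card A)"
  proof -
    have "C * (1 + s) \<le> \<bar>C\<bar> * (2 * s)" by (rule mult_mono) (use s in auto)
    also have "\<dots> = 2 * \<bar>C\<bar> * s" by simp
    also have "\<dots> < s * s" by (rule mult_strict_right_mono) (use s in auto)
    also have "\<dots> = real (card A)" by (simp add: s_def A(3))
    finally show ?thesis .
  qed
  moreover have "finite B" "B \<subseteq> {1..}" "card A \<le> card B" using A(3) N by (auto simp: B_def)
  ultimately show ?thesis using A(1) by blast
qed

section \<open>Existence of the basis\<close>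

lemma exists_basis_of_trace_bound:
  fixes ms ns f :: "nat \<Rightarrow> nat"
  defines "F \<equiv> bounded_trace_family f (range ns)"
  assumes ms: "\<And>k. 0 < ms k" and ns: "\<And>k. 0 < ns k"
    and f: "mono f" "\<And>i. 1 \<le> f i"
    and witness: "\<And>C. \<exists>A\<in>F. \<exists>B t. A \<subseteq> range ms \<and> finite B \<and> B \<subseteq> {1..} \<and>
      card A \<le> card B \<and> (\<forall>a\<in>A. \<forall>b\<in>B \<inter> range ms. a < b) \<and>
      (\<forall>S\<in>F. real (card (S \<inter> B)) \<le> t) \<and> C * t < real (card A)"
  shows "\<exists>(V :: (nat \<Rightarrow> 'k::{real_normed_field,banach,second_countable_topology}) set) nrm e es.
            banach_basis seq_scale V nrm e es \<and>
            banach_basis.one_unconditional seq_scale nrm e \<and>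
            banach_basis.one_PSLC seq_scale V nrm e es ns \<and>
            \<not> banach_basis.conservative nrm e ms \<and>
            \<not> banach_basis.democratic nrm e"
proof -
  interpret norming_family F
    unfolding F_def by (rule norming_family_bounded_trace[OF f(2)])
  let ?e = "unit_seq :: nat \<Rightarrow> nat \<Rightarrow> 'k"
  interpret B: banach_basis seq_scale "family_space :: (nat \<Rightarrow> 'k) set" family_norm ?e "\<lambda>n x. x n"
    by (rule coordinate_basis)
  have "B.one_PSLC ns"
    by (rule one_PSLC_coordinate_basis[OF ns])
      (unfold F_def, rule bounded_trace_exchange[OF f(1)])
  moreover have "\<not> B.conservative ms"
    by (rule not_conservative_coordinate_basis[OF ms witness])
  ultimately show ?thesis
    using B.democratic_imp_conservative[of ms] ms coordinate_basis one_unconditional_coordinate_basis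
    by blast
qed

lemma exists_PSLC_nonconservative_basis:
  fixes ms ns :: "nat \<Rightarrow> nat"
  assumes "strict_mono ms" and ms: "\<And>k. 0 < ms k"
    and "strict_mono ns" and ns: "\<And>k. 0 < ns k"
    and inf: "infinite (difference_set ms ns)"
  shows "\<exists>(V :: (nat \<Rightarrow> 'k::{real_normed_field,banach,second_countable_topology}) set) nrm e es.
            banach_basis seq_scale V nrm e es \<and>
            banach_basis.one_unconditional seq_scale nrm e \<and>
            banach_basis.one_PSLC seq_scale V nrm e es ns \<and>
            \<not> banach_basis.conservative nrm e ms \<and>
            \<not> banach_basis.democratic nrm e"
proof -
  have inf_range: "infinite (range ms)" "infinite (range ns)"
    using assms(1,3) by (simp_all add: range_inj_infinite strict_mono_imp_inj_on)
  have pos: "range ns \<subseteq> {1..}" using ns by (auto simp: Suc_le_eq)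
  have "difference_set ms ns = (range ms - range ns) \<union> (range ns - range ms)"
    by (auto simp: difference_set_def)
  then consider "infinite (range ms - range ns)" | "infinite (range ns - range ms)"
    using inf by auto
  then show ?thesis
  proof cases
    case 1
    show ?thesis
      by (rule exists_basis_of_trace_bound[OF ms ns _ _ trace_one_witness[OF 1 inf_range(2) pos]])
        (simp_all add: monoI)
  next
    case 2
    show ?thesis
      by (rule exists_basis_of_trace_bound[OF ms ns mono_slow_trace _
            slow_trace_witness[OF 2 pos inf_range(1)]]) simp
  qed
qed

theorem theorem5p3:
  fixes m n :: "nat \<Rightarrow> nat"
  assumes "strict_mono m" and "\<And>k. 0 < m k"
    and "strict_mono n" and "\<And>k. 0 < n k"
    and "infinite (difference_set m n)"
  shows "(\<exists>(V :: (nat \<Rightarrow> real) set) nrm e es.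
            banach_basis seq_scale V nrm e es \<and>
            banach_basis.one_unconditional seq_scale nrm e \<and>
            banach_basis.one_PSLC seq_scale V nrm e es n \<and>
            \<not> banach_basis.conservative nrm e m \<and>
            \<not> banach_basis.democratic nrm e) \<and>
         (\<exists>(V :: (nat \<Rightarrow> complex) set) nrm e es.
            banach_basis seq_scale V nrm e es \<and>
            banach_basis.one_unconditional seq_scale nrm e \<and>
            banach_basis.one_PSLC seq_scale V nrm e es n \<and>
            \<not> banach_basis.conservative nrm e m \<and>
            \<not> banach_basis.democratic nrm e)"
  using exists_PSLC_nonconservative_basis[OF assms] exists_PSLC_nonconservative_basis[OF assms]
  by (rule conjI)

end
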